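(* Let $\mathcal{A}\in\mathbb{C}^{I_1\times\cdots\times I_M\times J_1\times\cdots\times J_N}$ and $\mathcal{B}\in\mathbb{C}^{J_1\times\cdots\times J_N\times K_1\times\cdots\times K_L}$. Let $\mathcal{M}\in\mathbb{C}^{I_1\times\cdots\times I_M\times I_1\times\cdots\times I_M}$, $\mathcal{N}\in\mathbb{C}^{J_1\times\cdots\times J_N\times J_1\times\cdots\times J_N}$ and $\mathcal{L}\in\mathbb{C}^{K_1\times\cdots\times K_L\times K_1\times\cdots\times K_L}$ be Hermitian positive definite tensors. Then $(\mathcal{A}*_N\mathcal{B})^{\dagger}_{\mathcal{M}\mathcal{L}}=\mathcal{B}^{\dagger}_{\mathcal{N}\mathcal{L}}*_N\mathcal{A}^{\dagger}_{\mathcal{M}\mathcal{N}}$ if and only if $$\mathcal{A}^{\dagger}_{\mathcal{M}\mathcal{N}}*_M\mathcal{A}*_N\mathcal{B}=\mathcal{B}*_L(\mathcal{A}*_N\mathcal{B})^{\dagger}_{\mathcal{M}\mathcal{L}}*_M\mathcal{A}*_N\mathcal{B}$$ and $$\mathcal{B}*_L\mathcal{B}^{\dagger}_{\mathcal{N}\mathcal{L}}*_N\mathcal{A}^{\#}_{\mathcal{M}\mathcal{N}}=\mathcal{A}^{\#}_{\mathcal{M}\mathcal{N}}*_M\mathcal{A}*_N\mathcal{B}*_L(\mathcal{A}*_N\mathcal{B})^{\dagger}_{\mathcal{M}\mathcal{L}}.$$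
   Context: For $\mathcal{A}\in\mathbb{C}^{I_1\times\cdots\times I_M\times J_1\times\cdots\times J_N}$ and $\mathcal{B}\in\mathbb{C}^{J_1\times\cdots\times J_N\times K_1\times\cdots\times K_L}$ the Einstein product $*_N$ (contracting $N$ indices) is $(\mathcal{A}*_N\mathcal{B})_{i_1\cdots i_Mk_1\cdots k_L}=\sum_{j_1,\dots,j_N}a_{i_1\cdots i_Mj_1\cdots j_N}b_{j_1\cdots j_Nk_1\cdots k_L}$; $*_M,*_L,*_K$ are defined likewise. The conjugate transpose is $(\mathcal{A}^H)_{j_1\cdots j_Ni_1\cdots i_M}=\overline{a_{i_1\cdots i_Mj_1\cdots j_N}}$. In $\mathbb{C}^{I_1\times\cdots\times I_K\times I_1\times\cdots\times I_K}$: the identity tensor $\mathcal{I}$ has entries $\prod_k\delta_{i_kj_k}$; $\mathcal{U}$ is unitary if $\mathcal{U}*_K\mathcal{U}^H=\mathcal{U}^H*_K\mathcal{U}=\mathcal{I}$; $\mathcal{D}$ is diagonal if $d_{i_1\cdots i_Kj_1\cdots j_K}=0$ whenever $(i_1,\dots,i_K)\ne(j_1,\dots,j_K)$; $\mathcal{P}$ is Hermitian positive definite if $\mathcal{P}=\mathcal{U}*_K\mathcal{D}*_K\mathcal{U}^H$ with $\mathcal{U}$ unitary and $\mathcal{D}$ diagonal with positive diagonal entries; $\mathcal{P}^{-1}$ is the inverse with respect to $*_K$. For any $\mathcal{A}\in\mathbb{C}^{I_1\times\cdots\times I_M\times J_1\times\cdots\times J_N}$ and Hermitian positive definite $\mathcal{S}\in\mathbb{C}^{I_1\times\cdots\times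 I_M\times I_1\times\cdots\times I_M}$, $\mathcal{T}\in\mathbb{C}^{J_1\times\cdots\times J_N\times J_1\times\cdots\times J_N}$: the weighted conjugate transpose is $\mathcal{A}^{\#}_{\mathcal{S}\mathcal{T}}=\mathcal{T}^{-1}*_N\mathcal{A}^H*_M\mathcal{S}$, and the weighted Moore--Penrose inverse $\mathcal{A}^{\dagger}_{\mathcal{S}\mathcal{T}}$ is the unique $\mathcal{X}\in\mathbb{C}^{J_1\times\cdots\times J_N\times I_1\times\cdots\times I_M}$ satisfying $\mathcal{A}*_N\mathcal{X}*_M\mathcal{A}=\mathcal{A}$, $\mathcal{X}*_M\mathcal{A}*_N\mathcal{X}=\mathcal{X}$, $(\mathcal{S}*_M\mathcal{A}*_N\mathcal{X})^H=\mathcal{S}*_M\mathcal{A}*_N\mathcal{X}$, $(\mathcal{T}*_N\mathcal{X}*_M\mathcal{A})^H=\mathcal{T}*_N\mathcal{X}*_M\mathcal{A}$. *)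

theory Defs
  imports Complex_Main
begin

text \<open>
  A tuple of dimensions \<open>(I\<^sub>1, \<dots>, I\<^sub>M)\<close> is the list \<open>I\<close>, so that the order \<open>M\<close> is \<open>length I\<close>.
  Multi-indices are 0-based.
\<close>

definition valid_dims :: "nat list \<Rightarrow> bool" where
  "valid_dims I \<longleftrightarrow> I \<noteq> [] \<and> (\<forall>d\<in>set I. 1 \<le> d)"

definition multi_indices :: "nat list \<Rightarrow> nat list set" where
  "multi_indices I = {i. length i = length I \<and> (\<forall>k<length I. i ! k < I ! k)}"

text \<open>
  The entry \<open>a\<close> at position \<open>i\<^sub>1 \<dots> i\<^sub>M j\<^sub>1 \<dots> j\<^sub>N\<close> of a tensor of order \<open>M + N\<close> is
  \<open>A [i\<^sub>1, \<dots>, i\<^sub>M] [j\<^sub>1, \<dots>, j\<^sub>N]\<close>. Entries outside the index range are set to 0, so that equality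
  of tensors of the same shape is equality of functions.
\<close>

type_synonym tensor = "nat list \<Rightarrow> nat list \<Rightarrow> complex"

definition tensors :: "nat list \<Rightarrow> nat list \<Rightarrow> tensor set" where
  "tensors I J = {A. \<forall>i j. i \<notin> multi_indices I \<or> j \<notin> multi_indices J \<longrightarrow> A i j = 0}"

text \<open>
  The subscript is the tuple \<open>J\<close> of the contracted dimensions: \<open>A \<star>\<^bsub>J\<^esub> B\<close> contracts
  \<open>N = length J\<close> indices. It restricts to the correct shape since \<open>A\<close> and \<open>B\<close> are 0 out of range.
\<close>

definition einstein_prod :: "tensor \<Rightarrow> nat list \<Rightarrow> tensor \<Rightarrow> tensor"
    ("(_ \<star>\<^bsub>_\<^esub> _)" [70, 0, 71] 70) where
  "A \<star>\<^bsub>J\<^esub> B = (\<lambda>i k. \<Sum>j\<in>multi_indices J. A i j * B j k)"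

definition conj_transpose :: "tensor \<Rightarrow> tensor" where
  "conj_transpose A = (\<lambda>j i. cnj (A i j))"

definition id_tensor :: "nat list \<Rightarrow> tensor" where
  "id_tensor I = (\<lambda>i j. if i \<in> multi_indices I \<and> j \<in> multi_indices I
      then (\<Prod>k<length I. if i ! k = j ! k then 1 else 0) else 0)"

definition unitary_tensor :: "nat list \<Rightarrow> tensor \<Rightarrow> bool" where
  "unitary_tensor I U \<longleftrightarrow> U \<in> tensors I I \<and>
     U \<star>\<^bsub>I\<^esub> conj_transpose U = id_tensor I \<and> conj_transpose U \<star>\<^bsub>I\<^esub> U = id_tensor I"

definition diagonal_tensor :: "nat list \<Rightarrow> tensor \<Rightarrow> bool" where
  "diagonal_tensor I D \<longleftrightarrow> D \<in> tensors I I \<and>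
     (\<forall>i\<in>multi_indices I. \<forall>j\<in>multi_indices I. i \<noteq> j \<longrightarrow> D i j = 0)"

definition hermitian_pos_def :: "nat list \<Rightarrow> tensor \<Rightarrow> bool" where
  "hermitian_pos_def I P \<longleftrightarrow> P \<in> tensors I I \<and>
     (\<exists>U D. unitary_tensor I U \<and> diagonal_tensor I D \<and>
        (\<forall>i\<in>multi_indices I. D i i \<in> \<real> \<and> 0 < Re (D i i)) \<and>
        P = U \<star>\<^bsub>I\<^esub> D \<star>\<^bsub>I\<^esub> conj_transpose U)"

definition inv_tensor :: "nat list \<Rightarrow> tensor \<Rightarrow> tensor" where
  "inv_tensor I P = (THE Q. Q \<in> tensors I I \<and>
     P \<star>\<^bsub>I\<^esub> Q = id_tensor I \<and> Q \<star>\<^bsub>I\<^esub> P = id_tensor I)"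

definition weighted_conj_transpose ::
    "nat list \<Rightarrow> nat list \<Rightarrow> tensor \<Rightarrow> tensor \<Rightarrow> tensor \<Rightarrow> tensor" where
  "weighted_conj_transpose I J S T A = inv_tensor J T \<star>\<^bsub>J\<^esub> conj_transpose A \<star>\<^bsub>I\<^esub> S"

definition is_weighted_mp_inverse ::
    "nat list \<Rightarrow> nat list \<Rightarrow> tensor \<Rightarrow> tensor \<Rightarrow> tensor \<Rightarrow> tensor \<Rightarrow> bool" where
  "is_weighted_mp_inverse I J S T A X \<longleftrightarrow> X \<in> tensors J I \<and>
     A \<star>\<^bsub>J\<^esub> X \<star>\<^bsub>I\<^esub> A = A \<and>
     X \<star>\<^bsub>I\<^esub> A \<star>\<^bsub>J\<^esub> X = X \<and>
     conj_transpose (S \<star>\<^bsub>I\<^esub> A \<star>\<^bsub>J\<^esub> X) = S \<star>\<^bsub>I\<^esub> A \<star>\<^bsub>J\<^esub> X \<and>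
     conj_transpose (T \<star>\<^bsub>J\<^esub> X \<star>\<^bsub>I\<^esub> A) = T \<star>\<^bsub>J\<^esub> X \<star>\<^bsub>I\<^esub> A"

definition weighted_mp_inverse ::
    "nat list \<Rightarrow> nat list \<Rightarrow> tensor \<Rightarrow> tensor \<Rightarrow> tensor \<Rightarrow> tensor" where
  "weighted_mp_inverse I J S T A = (THE X. is_weighted_mp_inverse I J S T A X)"

end

theory Submission
  imports Defs "HOL-Library.Function_Algebras"
begin

text \<open>
  With respect to the inner products given by the weights, the weighted conjugate transpose is the
  adjoint and the weighted Moore--Penrose inverse is the ordinary one, so everything happens in a
  category with an involution in which \<open>Z\<^sup># Z = 0\<close> forces \<open>Z = 0\<close>. Put \<open>P = A\<^sup>\<dagger> A\<close>
  and \<open>Q = B B\<^sup>\<dagger>\<close>, two self-adjoint idempotents. If \<open>B\<^sup>\<dagger> A\<^sup>\<dagger>\<close> is the inverse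
  of \<open>A B\<close>, then \<open>P Q\<close> is idempotent, so \<open>P\<close> and \<open>Q\<close> commute, which gives both
  equations. Conversely, the first equation gives \<open>Q P Q = P Q\<close>, so that \<open>P\<close> and \<open>Q\<close>
  commute again, and the equations say that \<open>B\<^sup>\<dagger> A\<^sup>\<dagger> A B\<close> and
  \<open>A B B\<^sup>\<dagger> A\<^sup>\<dagger>\<close> are the orthogonal projections \<open>(A B)\<^sup>\<dagger> A B\<close> and
  \<open>A B (A B)\<^sup>\<dagger>\<close>.
\<close>

section \<open>Tensor algebra\<close>

lemma finite_multi_indices [simp]: "finite (multi_indices I)"
proof -
  have "multi_indices I \<subseteq> {i. set i \<subseteq> {..<Suc (sum_list I)} \<and> length i = length I}"
  proof
    fix i assume i: "i \<in> multi_indices I"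
    have "i ! k < Suc (sum_list I)" if "k < length I" for k
      using i that member_le_sum_list[of "I ! k" I] by (fastforce simp: multi_indices_def)
    with i show "i \<in> {i. set i \<subseteq> {..<Suc (sum_list I)} \<and> length i = length I}"
      by (auto simp: multi_indices_def in_set_conv_nth)
  qed
  then show ?thesis
    by (rule finite_subset) (rule finite_lists_length_eq, simp)
qed

text \<open>Distinct multi-indices of the same length differ at some position, so one factor of the
  product of deltas is 0. In this form the sum in a product with the identity collapses to one
  term.\<close>

lemma id_tensor_eq:
  "id_tensor I = (\<lambda>i j. if i \<in> multi_indices I \<and> i = j then 1 else 0)"
proof (intro ext)
  fix i j
  show "id_tensor I i j = (if i \<in> multi_indices I \<and> i = j then 1 else 0)"
  proof (cases "i \<in> multi_indices I \<and> j \<in> multi_indices I \<and> i \<noteq> j")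
    case True
    then obtain k where "k < length I" "i ! k \<noteq> j ! k"
      by (auto simp: multi_indices_def list_eq_iff_nth_eq)
    then have "(\<Prod>k<length I. if i ! k = j ! k then 1 else 0) = (0::complex)"
      by (intro prod_zero) auto
    with True show ?thesis by (simp add: id_tensor_def)
  qed (auto simp: id_tensor_def)
qed

lemma tensors_zeroD:
  assumes "A \<in> tensors I J" "i \<notin> multi_indices I \<or> j \<notin> multi_indices J"
  shows "A i j = 0"
  using assms by (auto simp: tensors_def)

lemma einstein_prod_in_tensors:
  "A \<in> tensors I J \<Longrightarrow> B \<in> tensors J K \<Longrightarrow> A \<star>\<^bsub>J\<^esub> B \<in> tensors I K"
  by (auto simp: tensors_def einstein_prod_def)

lemma conj_transpose_in_tensors: "A \<in> tensors I J \<Longrightarrow> conj_transpose A \<in> tensors J I"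
  by (auto simp: tensors_def conj_transpose_def)

lemma id_tensor_in_tensors: "id_tensor I \<in> tensors I I"
  by (auto simp: tensors_def id_tensor_eq)

lemma plus_in_tensors: "A \<in> tensors I J \<Longrightarrow> B \<in> tensors I J \<Longrightarrow> A + B \<in> tensors I J"
  and minus_in_tensors: "A \<in> tensors I J \<Longrightarrow> B \<in> tensors I J \<Longrightarrow> A - B \<in> tensors I J"
  by (auto simp: tensors_def)

lemmas tensor_closed = einstein_prod_in_tensors conj_transpose_in_tensors id_tensor_in_tensors
  plus_in_tensors minus_in_tensors

text \<open>Two finite sums are interchanged. As a rewrite rule this nests products to the right;
  its reverse regroups factors so that a known identity applies.\<close>

lemma einstein_prod_assoc: "(A \<star>\<^bsub>J\<^esub> B) \<star>\<^bsub>K\<^esub> C = A \<star>\<^bsub>J\<^esub> (B \<star>\<^bsub>K\<^esub> C)"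
proof (intro ext)
  fix i l
  have "((A \<star>\<^bsub>J\<^esub> B) \<star>\<^bsub>K\<^esub> C) i l
      = (\<Sum>k\<in>multi_indices K. \<Sum>j\<in>multi_indices J. A i j * B j k * C k l)"
    by (simp add: einstein_prod_def sum_distrib_right)
  also have "\<dots> = (\<Sum>j\<in>multi_indices J. \<Sum>k\<in>multi_indices K. A i j * B j k * C k l)"
    by (rule sum.swap)
  also have "\<dots> = (A \<star>\<^bsub>J\<^esub> (B \<star>\<^bsub>K\<^esub> C)) i l"
    by (simp add: einstein_prod_def sum_distrib_left mult.assoc)
  finally show "((A \<star>\<^bsub>J\<^esub> B) \<star>\<^bsub>K\<^esub> C) i l = (A \<star>\<^bsub>J\<^esub> (B \<star>\<^bsub>K\<^esub> C)) i l" .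
qed

lemma einstein_prod_distrib:
  "(A + B) \<star>\<^bsub>J\<^esub> C = A \<star>\<^bsub>J\<^esub> C + B \<star>\<^bsub>J\<^esub> C"
  "A \<star>\<^bsub>J\<^esub> (C + D) = A \<star>\<^bsub>J\<^esub> C + A \<star>\<^bsub>J\<^esub> D"
  "(A - B) \<star>\<^bsub>J\<^esub> C = A \<star>\<^bsub>J\<^esub> C - B \<star>\<^bsub>J\<^esub> C"
  "A \<star>\<^bsub>J\<^esub> (C - D) = A \<star>\<^bsub>J\<^esub> C - A \<star>\<^bsub>J\<^esub> D"
  by (auto simp: einstein_prod_def fun_eq_iff algebra_simps sum.distrib sum_subtractf)

lemma einstein_prod_zero [simp]: "A \<star>\<^bsub>J\<^esub> 0 = 0"
  by (auto simp: einstein_prod_def fun_eq_iff)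

lemma conj_transpose_simps [simp]:
  "conj_transpose (conj_transpose A) = A"
  "conj_transpose (A \<star>\<^bsub>J\<^esub> B) = conj_transpose B \<star>\<^bsub>J\<^esub> conj_transpose A"
  "conj_transpose (id_tensor I) = id_tensor I"
  by (auto simp: conj_transpose_def einstein_prod_def fun_eq_iff id_tensor_eq mult.commute)

lemma id_tensor_left: "A \<in> tensors I J \<Longrightarrow> id_tensor I \<star>\<^bsub>I\<^esub> A = A"
proof (intro ext)
  fix i j assume "A \<in> tensors I J"
  then show "(id_tensor I \<star>\<^bsub>I\<^esub> A) i j = A i j"
    by (cases "i \<in> multi_indices I")
      (auto simp: einstein_prod_def id_tensor_eq if_distrib[of "\<lambda>x. x * _"] tensors_zeroD
        cong: if_cong)
qed

lemma id_tensor_right: "A \<in> tensors I J \<Longrightarrow> A \<star>\<^bsub>J\<^esub> id_tensor J = A"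
  using arg_cong[where f = conj_transpose, OF id_tensor_left[of "conj_transpose A" J I]]
  by (simp add: tensor_closed)

text \<open>The diagonal entry at \<open>j\<close> of the product is the sum of the squared moduli
  in column \<open>j\<close> of \<open>A\<close>. This is the definiteness that later carries over
  to the weights.\<close>

lemma conj_transpose_self_prod_eq_0D:
  assumes A: "A \<in> tensors I J" and eq: "conj_transpose A \<star>\<^bsub>I\<^esub> A = 0"
  shows "A = 0"
proof (intro ext)
  fix i j
  have "complex_of_real (\<Sum>i\<in>multi_indices I. (cmod (A i j))\<^sup>2) = (conj_transpose A \<star>\<^bsub>I\<^esub> A) j j"
    by (simp add: einstein_prod_def conj_transpose_def complex_norm_square mult.commute
        flip: of_real_power)
  then have "(\<Sum>i\<in>multi_indices I. (cmod (A i j))\<^sup>2) = 0"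
    by (metis eq of_real_eq_0_iff zero_fun_apply)
  then have "\<forall>i\<in>multi_indices I. A i j = 0"
    by (subst (asm) sum_nonneg_eq_0_iff) auto
  then show "A i j = 0 i j" using A by (auto simp: tensors_def)
qed

section \<open>Generalized inverses\<close>

text \<open>
  Wedderburn rank reduction: if \<open>A i j \<noteq> 0\<close> and \<open>E\<close> has the single entry \<open>1 / A i j\<close> at
  position \<open>j i\<close>, then \<open>A - A E A\<close> has fewer nonzero rows than \<open>A\<close>, and a generalized
  inverse \<open>G'\<close> of it yields the generalized inverse \<open>(1 - E A) G' (1 - A E) + E\<close> of \<open>A\<close>.
\<close>

lemma generalized_inverse_exists:
  assumes "A \<in> tensors I J"
  shows "\<exists>G\<in>tensors J I. A \<star>\<^bsub>J\<^esub> (G \<star>\<^bsub>I\<^esub> A) = A"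
  using assms
proof (induction "card {i \<in> multi_indices I. \<exists>j. A i j \<noteq> 0}" arbitrary: A rule: less_induct)
  case less
  note A = \<open>A \<in> tensors I J\<close>
  show ?case
  proof (cases "A = 0")
    case True
    then show ?thesis by (intro bexI[of _ 0]) (auto simp: tensors_def)
  next
    case False
    then obtain i j where ij: "A i j \<noteq> 0" by (auto simp: fun_eq_iff)
    with A have i: "i \<in> multi_indices I" and j: "j \<in> multi_indices J"
      by (auto simp: tensors_def)
    define E :: tensor where "E = (\<lambda>j' i'. if j' = j \<and> i' = i then 1 / A i j else 0)"
    have E: "E \<in> tensors J I" using i j by (auto simp: tensors_def E_def)
    have EA: "(E \<star>\<^bsub>I\<^esub> A) = (\<lambda>j' c. if j' = j then A i c / A i j else 0)"
      using i by (auto simp: E_def einstein_prod_def fun_eq_iff if_distrib[of "\<lambda>x. x * _"] cong: if_cong)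
    have AEA: "(A \<star>\<^bsub>J\<^esub> (E \<star>\<^bsub>I\<^esub> A)) = (\<lambda>r c. A r j * A i c / A i j)"
      unfolding EA using j
      by (auto simp: einstein_prod_def fun_eq_iff if_distrib[of "\<lambda>x. _ * x"] cong: if_cong)
    define A' where "A' = A - A \<star>\<^bsub>J\<^esub> (E \<star>\<^bsub>I\<^esub> A)"
    have A': "A' \<in> tensors I J" unfolding A'_def by (intro tensor_closed A E)
    have A'_eq: "A' r c = A r c - A r j * A i c / A i j" for r c
      by (simp add: A'_def AEA)
    \<comment> \<open>Row \<open>i\<close> of \<open>A'\<close> vanishes, and a zero row of
      \<open>A\<close> stays zero in \<open>A'\<close>.\<close>
    have "{r \<in> multi_indices I. \<exists>c. A' r c \<noteq> 0} \<subset> {r \<in> multi_indices I. \<exists>c. A r c \<noteq> 0}"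
    proof
      show "{r \<in> multi_indices I. \<exists>c. A' r c \<noteq> 0} \<subseteq> {r \<in> multi_indices I. \<exists>c. A r c \<noteq> 0}"
        unfolding A'_eq by (clarify, rule ccontr, simp)
      have "i \<notin> {r \<in> multi_indices I. \<exists>c. A' r c \<noteq> 0}"
        using ij by (simp add: A'_eq)
      moreover have "i \<in> {r \<in> multi_indices I. \<exists>c. A r c \<noteq> 0}"
        using i ij by auto
      ultimately show "{r \<in> multi_indices I. \<exists>c. A' r c \<noteq> 0} \<noteq> {r \<in> multi_indices I. \<exists>c. A r c \<noteq> 0}"
        by blast
    qed
    then have "card {r \<in> multi_indices I. \<exists>c. A' r c \<noteq> 0} < card {r \<in> multi_indices I. \<exists>c. A r c \<noteq> 0}"
      by (intro psubset_card_mono) auto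
    from less.hyps[OF this A'] obtain G'
      where G': "G' \<in> tensors J I" and A'G'A': "A' \<star>\<^bsub>J\<^esub> (G' \<star>\<^bsub>I\<^esub> A') = A'" by blast
    \<comment> \<open>This is \<open>(1 - E A) G' (1 - A E) + E\<close>, multiplied out so that no
      identity tensor occurs.\<close>
    define G where "G = (G' - E \<star>\<^bsub>I\<^esub> (A \<star>\<^bsub>J\<^esub> G')) - (G' - E \<star>\<^bsub>I\<^esub> (A \<star>\<^bsub>J\<^esub> G')) \<star>\<^bsub>I\<^esub> (A \<star>\<^bsub>J\<^esub> E) + E"
    have "G \<in> tensors J I" unfolding G_def by (intro tensor_closed A E G')
    \<comment> \<open>Both \<open>A (1 - E A)\<close> and \<open>(1 - A E) A\<close> are
      \<open>A'\<close>.\<close>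
    moreover have "A \<star>\<^bsub>J\<^esub> (G \<star>\<^bsub>I\<^esub> A) = A' \<star>\<^bsub>J\<^esub> (G' \<star>\<^bsub>I\<^esub> A') + A \<star>\<^bsub>J\<^esub> (E \<star>\<^bsub>I\<^esub> A)"
      by (simp add: G_def A'_def einstein_prod_distrib einstein_prod_assoc)
    then have "A \<star>\<^bsub>J\<^esub> (G \<star>\<^bsub>I\<^esub> A) = A"
      unfolding A'G'A' by (simp add: A'_def)
    ultimately show ?thesis by blast
  qed
qed

section \<open>Hermitian positive definite weights\<close>

text \<open>With \<open>d\<close> the positive square roots of the diagonal of \<open>D\<close>, the
  choice is \<open>R = diag d U\<^sup>H\<close> and \<open>R' = U (diag d)\<^sup>-\<^sup>1\<close>.
  Realness of the entries makes each \<open>D i i\<close> the square of \<open>d i\<close>.\<close>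

lemma hermitian_pos_def_factorization:
  assumes "hermitian_pos_def I S"
  obtains R R' where "R \<in> tensors I I" "R' \<in> tensors I I"
    "R \<star>\<^bsub>I\<^esub> R' = id_tensor I" "R' \<star>\<^bsub>I\<^esub> R = id_tensor I" "S = conj_transpose R \<star>\<^bsub>I\<^esub> R"
proof -
  from assms obtain U D where U: "U \<in> tensors I I"
    and UU: "U \<star>\<^bsub>I\<^esub> conj_transpose U = id_tensor I" "conj_transpose U \<star>\<^bsub>I\<^esub> U = id_tensor I"
    and D: "D \<in> tensors I I" "\<forall>i\<in>multi_indices I. \<forall>j\<in>multi_indices I. i \<noteq> j \<longrightarrow> D i j = 0"
    and pos: "\<forall>i\<in>multi_indices I. D i i \<in> \<real> \<and> 0 < Re (D i i)"
    and S_eq: "S = U \<star>\<^bsub>I\<^esub> D \<star>\<^bsub>I\<^esub> conj_transpose U"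
    by (auto simp: hermitian_pos_def_def unitary_tensor_def diagonal_tensor_def)
  define diag :: "(nat list \<Rightarrow> real) \<Rightarrow> tensor" where
    "diag f = (\<lambda>i j. if i \<in> multi_indices I \<and> i = j then complex_of_real (f i) else 0)" for f
  have diag: "diag f \<in> tensors I I" for f by (auto simp: diag_def tensors_def)
  have diag_mult: "diag f \<star>\<^bsub>I\<^esub> diag g = diag (\<lambda>i. f i * g i)" for f g
  proof (intro ext)
    fix i j show "(diag f \<star>\<^bsub>I\<^esub> diag g) i j = diag (\<lambda>i. f i * g i) i j"
      by (cases "i \<in> multi_indices I")
        (auto simp: diag_def einstein_prod_def if_distrib[of "\<lambda>x. x * _"] cong: if_cong)
  qed
  have ct_diag: "conj_transpose (diag f) = diag f" for f
    by (auto simp: diag_def conj_transpose_def fun_eq_iff)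
  define d where "d i = sqrt (Re (D i i))" for i
  have D_eq: "D = diag d \<star>\<^bsub>I\<^esub> diag d"
    using D pos unfolding diag_mult
    by (auto simp: diag_def d_def fun_eq_iff tensors_def abs_of_pos)
  have inv: "diag d \<star>\<^bsub>I\<^esub> diag (\<lambda>i. 1 / d i) = id_tensor I"
     "diag (\<lambda>i. 1 / d i) \<star>\<^bsub>I\<^esub> diag d = id_tensor I"
    unfolding diag_mult using pos by (force simp: diag_def id_tensor_eq d_def fun_eq_iff)+
  show ?thesis
  proof (rule that)
    let ?R = "diag d \<star>\<^bsub>I\<^esub> conj_transpose U" and ?R' = "U \<star>\<^bsub>I\<^esub> diag (\<lambda>i. 1 / d i)"
    show "?R \<in> tensors I I" "?R' \<in> tensors I I" by (intro tensor_closed diag U)+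
    have "?R \<star>\<^bsub>I\<^esub> ?R' = diag d \<star>\<^bsub>I\<^esub> ((conj_transpose U \<star>\<^bsub>I\<^esub> U) \<star>\<^bsub>I\<^esub> diag (\<lambda>i. 1 / d i))"
      by (simp add: einstein_prod_assoc)
    then show "?R \<star>\<^bsub>I\<^esub> ?R' = id_tensor I"
      by (simp add: UU id_tensor_left[OF diag] inv)
    have "?R' \<star>\<^bsub>I\<^esub> ?R = U \<star>\<^bsub>I\<^esub> ((diag (\<lambda>i. 1 / d i) \<star>\<^bsub>I\<^esub> diag d) \<star>\<^bsub>I\<^esub> conj_transpose U)"
      by (simp add: einstein_prod_assoc)
    then show "?R' \<star>\<^bsub>I\<^esub> ?R = id_tensor I"
      by (simp add: UU inv id_tensor_left[OF conj_transpose_in_tensors[OF U]])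
    show "S = conj_transpose ?R \<star>\<^bsub>I\<^esub> ?R"
      by (simp add: S_eq D_eq ct_diag einstein_prod_assoc)
  qed
qed

lemma inv_tensor_eqI:
  assumes "S \<in> tensors I I" "Q \<in> tensors I I" "S \<star>\<^bsub>I\<^esub> Q = id_tensor I" "Q \<star>\<^bsub>I\<^esub> S = id_tensor I"
  shows "inv_tensor I S = Q"
  unfolding inv_tensor_def
proof (rule the_equality)
  fix Q' assume Q': "Q' \<in> tensors I I \<and> S \<star>\<^bsub>I\<^esub> Q' = id_tensor I \<and> Q' \<star>\<^bsub>I\<^esub> S = id_tensor I"
  have "(Q \<star>\<^bsub>I\<^esub> S) \<star>\<^bsub>I\<^esub> Q' = Q \<star>\<^bsub>I\<^esub> (S \<star>\<^bsub>I\<^esub> Q')" by (rule einstein_prod_assoc)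
  then show "Q' = Q" using assms Q' by (simp add: id_tensor_left[of Q' I I] id_tensor_right[of Q I I])
qed (use assms in auto)

text \<open>From \<open>S = R\<^sup>H R\<close> with \<open>R'\<close> inverse to \<open>R\<close>,
  the inverse of \<open>S\<close> is \<open>R' R'\<^sup>H\<close>; both products are visibly
  Hermitian.\<close>

lemma hermitian_pos_def_weight:
  assumes "hermitian_pos_def I S"
  shows "S \<in> tensors I I" "inv_tensor I S \<in> tensors I I"
    "S \<star>\<^bsub>I\<^esub> inv_tensor I S = id_tensor I" "inv_tensor I S \<star>\<^bsub>I\<^esub> S = id_tensor I"
    "conj_transpose S = S" "conj_transpose (inv_tensor I S) = inv_tensor I S"
proof -
  obtain R R' where R: "R \<in> tensors I I" "R' \<in> tensors I I"
    "R \<star>\<^bsub>I\<^esub> R' = id_tensor I" "R' \<star>\<^bsub>I\<^esub> R = id_tensor I" and S: "S = conj_transpose R \<star>\<^bsub>I\<^esub> R"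
    by (rule hermitian_pos_def_factorization[OF assms])
  note ct = conj_transpose_in_tensors[OF R(1)] conj_transpose_in_tensors[OF R(2)]
  have R': "conj_transpose R' \<star>\<^bsub>I\<^esub> conj_transpose R = id_tensor I"
     "conj_transpose R \<star>\<^bsub>I\<^esub> conj_transpose R' = id_tensor I"
    using R(3,4)[THEN arg_cong[of _ _ conj_transpose]] by simp_all
  define Q where "Q = R' \<star>\<^bsub>I\<^esub> conj_transpose R'"
  show St: "S \<in> tensors I I" unfolding S by (intro tensor_closed R)
  have Qt: "Q \<in> tensors I I" unfolding Q_def by (intro tensor_closed R)
  have "S \<star>\<^bsub>I\<^esub> Q = conj_transpose R \<star>\<^bsub>I\<^esub> ((R \<star>\<^bsub>I\<^esub> R') \<star>\<^bsub>I\<^esub> conj_transpose R')"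
    by (simp add: S Q_def einstein_prod_assoc)
  then have SQ: "S \<star>\<^bsub>I\<^esub> Q = id_tensor I" by (simp add: R R' id_tensor_left[OF ct(2)])
  have "Q \<star>\<^bsub>I\<^esub> S = R' \<star>\<^bsub>I\<^esub> ((conj_transpose R' \<star>\<^bsub>I\<^esub> conj_transpose R) \<star>\<^bsub>I\<^esub> R)"
    by (simp add: S Q_def einstein_prod_assoc)
  then have QS: "Q \<star>\<^bsub>I\<^esub> S = id_tensor I" by (simp add: R' R id_tensor_left[OF R(1)])
  have eq: "inv_tensor I S = Q" by (rule inv_tensor_eqI[OF St Qt SQ QS])
  show "inv_tensor I S \<in> tensors I I" "S \<star>\<^bsub>I\<^esub> inv_tensor I S = id_tensor I"
    "inv_tensor I S \<star>\<^bsub>I\<^esub> S = id_tensor I" using Qt SQ QS by (simp_all add: eq)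
  show "conj_transpose S = S" "conj_transpose (inv_tensor I S) = inv_tensor I S"
    unfolding eq by (simp add: S, simp add: Q_def)
qed

lemma weight_cancel:
  assumes S: "hermitian_pos_def I S" and A: "A \<in> tensors I J"
  shows "S \<star>\<^bsub>I\<^esub> (inv_tensor I S \<star>\<^bsub>I\<^esub> A) = A" "inv_tensor I S \<star>\<^bsub>I\<^esub> (S \<star>\<^bsub>I\<^esub> A) = A"
  using hermitian_pos_def_weight[OF S] id_tensor_left[OF A]
  by (simp_all flip: einstein_prod_assoc)

section \<open>Adjoints with respect to the weighted inner products\<close>

lemma weighted_conj_transpose_in_tensors:
  assumes "hermitian_pos_def I S" "hermitian_pos_def J T" "A \<in> tensors I J"
  shows "weighted_conj_transpose I J S T A \<in> tensors J I"
  unfolding weighted_conj_transpose_def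
  by (intro tensor_closed hermitian_pos_def_weight assms)

lemma weighted_conj_transpose_twice:
  assumes S: "hermitian_pos_def I S" and T: "hermitian_pos_def J T" and A: "A \<in> tensors I J"
  shows "weighted_conj_transpose J I T S (weighted_conj_transpose I J S T A) = A"
proof -
  note wS = hermitian_pos_def_weight[OF S] and wT = hermitian_pos_def_weight[OF T]
  show ?thesis
    using A by (simp add: weighted_conj_transpose_def einstein_prod_assoc wS wT
        weight_cancel[OF S] id_tensor_right)
qed

text \<open>On the right, \<open>T\<close> from the adjoint of \<open>B\<close> meets the inverse of
  \<open>T\<close> from the adjoint of \<open>A\<close>, and the two cancel.\<close>

lemma weighted_conj_transpose_prod:
  assumes T: "hermitian_pos_def J T" and A: "A \<in> tensors I J"
  shows "weighted_conj_transpose I K S U (A \<star>\<^bsub>J\<^esub> B) =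
    weighted_conj_transpose J K T U B \<star>\<^bsub>J\<^esub> weighted_conj_transpose I J S T A"
  using weight_cancel[OF T conj_transpose_in_tensors[OF A]]
  by (simp add: weighted_conj_transpose_def flip: einstein_prod_assoc)
    (simp add: einstein_prod_assoc)

text \<open>Multiplying the product by \<open>T\<close> leaves
  \<open>A\<^sup>H S A = (R A)\<^sup>H (R A)\<close>, where \<open>S = R\<^sup>H R\<close>. The
  unweighted case gives \<open>R A = 0\<close>, and \<open>R\<close> is invertible.\<close>

lemma weighted_conj_transpose_self_prod_eq_0D:
  assumes S: "hermitian_pos_def I S" and T: "hermitian_pos_def J T" and A: "A \<in> tensors I J"
    and eq: "weighted_conj_transpose I J S T A \<star>\<^bsub>I\<^esub> A = 0"
  shows "A = 0"
proof -
  note wS = hermitian_pos_def_weight[OF S]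
  obtain R R' where R: "R \<in> tensors I I" "R' \<in> tensors I I"
    "R' \<star>\<^bsub>I\<^esub> R = id_tensor I" "S = conj_transpose R \<star>\<^bsub>I\<^esub> R"
    by (rule hermitian_pos_def_factorization[OF S])
  have "conj_transpose A \<star>\<^bsub>I\<^esub> (S \<star>\<^bsub>I\<^esub> A) \<in> tensors J J"
    by (intro tensor_closed A wS)
  from weight_cancel(1)[OF T this]
  have "conj_transpose A \<star>\<^bsub>I\<^esub> (S \<star>\<^bsub>I\<^esub> A) =
      T \<star>\<^bsub>J\<^esub> (weighted_conj_transpose I J S T A \<star>\<^bsub>I\<^esub> A)"
    by (simp add: weighted_conj_transpose_def einstein_prod_assoc)
  then have "conj_transpose (R \<star>\<^bsub>I\<^esub> A) \<star>\<^bsub>I\<^esub> (R \<star>\<^bsub>I\<^esub> A) = 0"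
    unfolding eq by (simp add: R(4) einstein_prod_assoc)
  then have RA: "R \<star>\<^bsub>I\<^esub> A = 0"
    by (rule conj_transpose_self_prod_eq_0D[of _ I J, rotated]) (intro tensor_closed R A)
  have "A = (R' \<star>\<^bsub>I\<^esub> R) \<star>\<^bsub>I\<^esub> A" by (simp add: R id_tensor_left[OF A])
  also have "\<dots> = 0" by (simp add: einstein_prod_assoc RA)
  finally show ?thesis .
qed

lemma weighted_conj_transpose_diff:
  "weighted_conj_transpose I J S T (A - B) =
    weighted_conj_transpose I J S T A - weighted_conj_transpose I J S T B"
proof -
  have "conj_transpose (A - B) = conj_transpose A - conj_transpose B"
    by (simp add: conj_transpose_def fun_eq_iff)
  then show ?thesis by (simp add: weighted_conj_transpose_def einstein_prod_distrib)
qed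

text \<open>For \<open>Z = A (B - C)\<close> the hypothesis makes the adjoint of \<open>Z\<close>
  times \<open>Z\<close> vanish, so definiteness applies.\<close>

lemma weighted_conj_transpose_self_prod_cancel:
  assumes S: "hermitian_pos_def I S" and T: "hermitian_pos_def J T" and U: "hermitian_pos_def K U"
    and A: "A \<in> tensors I J" and B: "B \<in> tensors J K" and C: "C \<in> tensors J K"
    and eq: "weighted_conj_transpose I J S T A \<star>\<^bsub>I\<^esub> (A \<star>\<^bsub>J\<^esub> B) =
             weighted_conj_transpose I J S T A \<star>\<^bsub>I\<^esub> (A \<star>\<^bsub>J\<^esub> C)"
  shows "A \<star>\<^bsub>J\<^esub> B = A \<star>\<^bsub>J\<^esub> C"
proof -
  let ?Z = "A \<star>\<^bsub>J\<^esub> (B - C)"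
  have "weighted_conj_transpose I K S U ?Z \<star>\<^bsub>I\<^esub> ?Z = 0"
    unfolding weighted_conj_transpose_prod[OF T A]
    by (simp add: einstein_prod_assoc einstein_prod_distrib eq)
  then have "?Z = 0"
    by (rule weighted_conj_transpose_self_prod_eq_0D[OF S U, rotated]) (intro tensor_closed A B C)
  then show ?thesis by (simp add: einstein_prod_distrib)
qed

text \<open>As \<open>S\<close> is Hermitian, the left side reads \<open>A\<^sup>H S = S A\<close>;
  multiplication by the inverse of \<open>S\<close>, or back by \<open>S\<close>, passes between the
  two forms.\<close>

lemma weighted_self_adjoint_iff:
  assumes S: "hermitian_pos_def I S" and A: "A \<in> tensors I I"
  shows "conj_transpose (S \<star>\<^bsub>I\<^esub> A) = S \<star>\<^bsub>I\<^esub> A \<longleftrightarrow> weighted_conj_transpose I I S S A = A"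
proof -
  note w = hermitian_pos_def_weight[OF S]
  have "conj_transpose A \<star>\<^bsub>I\<^esub> S \<in> tensors I I" by (intro tensor_closed A w)
  note c = weight_cancel[OF S this] and cA = weight_cancel[OF S A]
  show ?thesis
    by (simp add: weighted_conj_transpose_def einstein_prod_assoc w) (metis c cA)
qed

section \<open>The weighted Moore--Penrose inverse\<close>

lemma is_weighted_mp_inverse_iff:
  assumes S: "hermitian_pos_def I S" and T: "hermitian_pos_def J T" and A: "A \<in> tensors I J"
  shows "is_weighted_mp_inverse I J S T A X \<longleftrightarrow> X \<in> tensors J I \<and>
     A \<star>\<^bsub>J\<^esub> (X \<star>\<^bsub>I\<^esub> A) = A \<and> X \<star>\<^bsub>I\<^esub> (A \<star>\<^bsub>J\<^esub> X) = X \<and>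
     weighted_conj_transpose I I S S (A \<star>\<^bsub>J\<^esub> X) = A \<star>\<^bsub>J\<^esub> X \<and>
     weighted_conj_transpose J J T T (X \<star>\<^bsub>I\<^esub> A) = X \<star>\<^bsub>I\<^esub> A"
proof (cases "X \<in> tensors J I")
  case True
  then have "A \<star>\<^bsub>J\<^esub> X \<in> tensors I I" "X \<star>\<^bsub>I\<^esub> A \<in> tensors J J"
    by (intro tensor_closed A; assumption)+
  then show ?thesis
    by (simp only: is_weighted_mp_inverse_def einstein_prod_assoc True
        weighted_self_adjoint_iff[OF S] weighted_self_adjoint_iff[OF T])
qed (simp add: is_weighted_mp_inverse_def)

text \<open>The adjoint of \<open>A X = (A Y) (A X)\<close> is
  \<open>A X = (A X) (A Y) = A Y\<close>, and \<open>X A = Y A\<close> follows in the same way.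
  Hence \<open>X = X A X = Y A Y = Y\<close>.\<close>

lemma weighted_mp_inverse_unique:
  assumes S: "hermitian_pos_def I S" and T: "hermitian_pos_def J T" and A: "A \<in> tensors I J"
    and "is_weighted_mp_inverse I J S T A X" "is_weighted_mp_inverse I J S T A Y"
  shows "X = Y"
proof -
  note X = assms(4)[unfolded is_weighted_mp_inverse_iff[OF S T A]]
    and Y = assms(5)[unfolded is_weighted_mp_inverse_iff[OF S T A]]
  have t: "A \<star>\<^bsub>J\<^esub> X \<in> tensors I I" "A \<star>\<^bsub>J\<^esub> Y \<in> tensors I I"
      "X \<star>\<^bsub>I\<^esub> A \<in> tensors J J" "Y \<star>\<^bsub>I\<^esub> A \<in> tensors J J"
    using X Y by (auto intro!: tensor_closed A)
  have "A \<star>\<^bsub>J\<^esub> X = (A \<star>\<^bsub>J\<^esub> Y) \<star>\<^bsub>I\<^esub> (A \<star>\<^bsub>J\<^esub> X)"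
    using Y by (metis einstein_prod_assoc)
  then have "A \<star>\<^bsub>J\<^esub> X = (A \<star>\<^bsub>J\<^esub> X) \<star>\<^bsub>I\<^esub> (A \<star>\<^bsub>J\<^esub> Y)"
    using weighted_conj_transpose_prod[OF S t(2), of I S S "A \<star>\<^bsub>J\<^esub> X"] X Y by metis
  also have "\<dots> = A \<star>\<^bsub>J\<^esub> Y" using X by (metis einstein_prod_assoc)
  finally have AX: "A \<star>\<^bsub>J\<^esub> X = A \<star>\<^bsub>J\<^esub> Y" .
  have "X \<star>\<^bsub>I\<^esub> A = (X \<star>\<^bsub>I\<^esub> A) \<star>\<^bsub>J\<^esub> (Y \<star>\<^bsub>I\<^esub> A)"
    using Y by (metis einstein_prod_assoc)
  then have "X \<star>\<^bsub>I\<^esub> A = (Y \<star>\<^bsub>I\<^esub> A) \<star>\<^bsub>J\<^esub> (X \<star>\<^bsub>I\<^esub> A)"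
    using weighted_conj_transpose_prod[OF T t(3), of J T T "Y \<star>\<^bsub>I\<^esub> A"] X Y by metis
  also have "\<dots> = Y \<star>\<^bsub>I\<^esub> A" using X by (metis einstein_prod_assoc)
  finally have XA: "X \<star>\<^bsub>I\<^esub> A = Y \<star>\<^bsub>I\<^esub> A" .
  have "X = X \<star>\<^bsub>I\<^esub> (A \<star>\<^bsub>J\<^esub> X)" using X by simp
  also have "\<dots> = Y \<star>\<^bsub>I\<^esub> (A \<star>\<^bsub>J\<^esub> Y)" using AX XA by (metis einstein_prod_assoc)
  also have "\<dots> = Y" using Y by simp
  finally show ?thesis .
qed

text \<open>The witness is \<open>H A'\<close>, where \<open>A'\<close> is the adjoint of
  \<open>A\<close> and \<open>H\<close> a generalized inverse of \<open>A' A\<close>, as in the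
  normal equations.\<close>

lemma weighted_least_squares_inverse_exists:
  assumes S: "hermitian_pos_def I S" and T: "hermitian_pos_def J T" and A: "A \<in> tensors I J"
  shows "\<exists>X\<in>tensors J I. A \<star>\<^bsub>J\<^esub> (X \<star>\<^bsub>I\<^esub> A) = A \<and>
    weighted_conj_transpose I I S S (A \<star>\<^bsub>J\<^esub> X) = A \<star>\<^bsub>J\<^esub> X"
proof -
  let ?adj = "weighted_conj_transpose"
  define A' where "A' = ?adj I J S T A"
  have A': "A' \<in> tensors J I"
    unfolding A'_def by (rule weighted_conj_transpose_in_tensors[OF S T A])
  have A'': "?adj J I T S A' = A"
    unfolding A'_def by (rule weighted_conj_transpose_twice[OF S T A])
  have "A' \<star>\<^bsub>I\<^esub> A \<in> tensors J J" by (intro tensor_closed A A')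
  from generalized_inverse_exists[OF this] obtain H
    where H: "H \<in> tensors J J" and G: "A' \<star>\<^bsub>I\<^esub> (A \<star>\<^bsub>J\<^esub> (H \<star>\<^bsub>J\<^esub> (A' \<star>\<^bsub>I\<^esub> A))) = A' \<star>\<^bsub>I\<^esub> A"
    by (auto simp: einstein_prod_assoc)
  define H' where "H' = ?adj J J T T H"
  have H': "H' \<in> tensors J J"
    unfolding H'_def by (rule weighted_conj_transpose_in_tensors[OF T T H])
  have adj_G: "?adj J J T T (A' \<star>\<^bsub>I\<^esub> A) = A' \<star>\<^bsub>I\<^esub> A"
    by (simp add: weighted_conj_transpose_prod[OF S A'] A'') (simp add: A'_def)
  have "?adj J J T T ((A' \<star>\<^bsub>I\<^esub> A) \<star>\<^bsub>J\<^esub> (H \<star>\<^bsub>J\<^esub> (A' \<star>\<^bsub>I\<^esub> A))) =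
      (A' \<star>\<^bsub>I\<^esub> A) \<star>\<^bsub>J\<^esub> H' \<star>\<^bsub>J\<^esub> (A' \<star>\<^bsub>I\<^esub> A)"
    by (simp add: weighted_conj_transpose_prod[OF T \<open>A' \<star>\<^bsub>I\<^esub> A \<in> tensors J J\<close>]
        weighted_conj_transpose_prod[OF T H] adj_G H'_def)
  then have G': "A' \<star>\<^bsub>I\<^esub> (A \<star>\<^bsub>J\<^esub> (H' \<star>\<^bsub>J\<^esub> (A' \<star>\<^bsub>I\<^esub> A))) = A' \<star>\<^bsub>I\<^esub> A"
    using G adj_G by (simp add: einstein_prod_assoc)
  \<comment> \<open>The leading \<open>A'\<close> is stripped by comparing \<open>W A' A\<close>
    with the identity under \<open>A' A\<close>.\<close>
  have cancel: "A \<star>\<^bsub>J\<^esub> (W \<star>\<^bsub>J\<^esub> (A' \<star>\<^bsub>I\<^esub> A)) = A"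
    if W: "W \<in> tensors J J" "A' \<star>\<^bsub>I\<^esub> (A \<star>\<^bsub>J\<^esub> (W \<star>\<^bsub>J\<^esub> (A' \<star>\<^bsub>I\<^esub> A))) = A' \<star>\<^bsub>I\<^esub> A" for W
  proof -
    have "A \<star>\<^bsub>J\<^esub> (W \<star>\<^bsub>J\<^esub> (A' \<star>\<^bsub>I\<^esub> A)) = A \<star>\<^bsub>J\<^esub> id_tensor J"
    proof (rule weighted_conj_transpose_self_prod_cancel[OF S T T A])
      show "W \<star>\<^bsub>J\<^esub> (A' \<star>\<^bsub>I\<^esub> A) \<in> tensors J J" by (intro tensor_closed W A A')
    qed (use W A in \<open>simp_all add: id_tensor_right id_tensor_in_tensors flip: A'_def\<close>)
    then show ?thesis by (simp add: id_tensor_right[OF A])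
  qed
  define E where "E = A \<star>\<^bsub>J\<^esub> (H \<star>\<^bsub>J\<^esub> A')"
  define E' where "E' = A \<star>\<^bsub>J\<^esub> (H' \<star>\<^bsub>J\<^esub> A')"
  have E: "E \<in> tensors I I" and E': "E' \<in> tensors I I"
    unfolding E_def E'_def by (intro tensor_closed A A' H H')+
  have adj_E: "?adj I I S S E = E'"
    unfolding E_def E'_def weighted_conj_transpose_prod[OF T A] weighted_conj_transpose_prod[OF T H] A''
    by (simp add: einstein_prod_assoc flip: A'_def H'_def)
  then have adj_E': "?adj I I S S E' = E"
    using weighted_conj_transpose_twice[OF S S E] by simp
  \<comment> \<open>Self-adjointness of \<open>E = A H A'\<close>: its adjoint is \<open>E'\<close>,
    and \<open>E E'\<close> is self-adjoint and equal to \<open>E'\<close>, so \<open>E'\<close> is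
    self-adjoint and coincides with \<open>E\<close>.\<close>
  have "E \<star>\<^bsub>I\<^esub> E' = (A \<star>\<^bsub>J\<^esub> (H \<star>\<^bsub>J\<^esub> (A' \<star>\<^bsub>I\<^esub> A))) \<star>\<^bsub>J\<^esub> (H' \<star>\<^bsub>J\<^esub> A')"
    by (simp add: E_def E'_def einstein_prod_assoc)
  then have EE': "E \<star>\<^bsub>I\<^esub> E' = E'" by (simp add: cancel[OF H G] E'_def)
  have "?adj I I S S (E \<star>\<^bsub>I\<^esub> E') = E \<star>\<^bsub>I\<^esub> E'"
    by (simp add: weighted_conj_transpose_prod[OF S E] adj_E adj_E')
  with EE' adj_E' have "E = E'" by simp
  with adj_E have "?adj I I S S E = E" by simp
  moreover have "H \<star>\<^bsub>J\<^esub> A' \<in> tensors J I" by (intro tensor_closed H A')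
  ultimately show ?thesis
    using cancel[OF H G] by (intro bexI[of _ "H \<star>\<^bsub>J\<^esub> A'"]) (auto simp: E_def einstein_prod_assoc)
qed

text \<open>
  Urquhart's formula: if \<open>A X\<close> and \<open>W A\<close> are self-adjoint and \<open>A X A = A = A W A\<close>, then
  \<open>W A X\<close> is the Moore--Penrose inverse. Such a \<open>W\<close> is the adjoint of a least squares inverse
  of the adjoint of \<open>A\<close>.
\<close>

lemma weighted_mp_inverse_exists:
  assumes S: "hermitian_pos_def I S" and T: "hermitian_pos_def J T" and A: "A \<in> tensors I J"
  shows "\<exists>X. is_weighted_mp_inverse I J S T A X"
proof -
  let ?adj = "weighted_conj_transpose"
  obtain X where X: "X \<in> tensors J I" and AXA: "A \<star>\<^bsub>J\<^esub> (X \<star>\<^bsub>I\<^esub> A) = A"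
    and adj_AX: "?adj I I S S (A \<star>\<^bsub>J\<^esub> X) = A \<star>\<^bsub>J\<^esub> X"
    using weighted_least_squares_inverse_exists[OF S T A] by blast
  define A' where "A' = ?adj I J S T A"
  have A': "A' \<in> tensors J I"
    unfolding A'_def by (rule weighted_conj_transpose_in_tensors[OF S T A])
  have A'': "?adj J I T S A' = A"
    unfolding A'_def by (rule weighted_conj_transpose_twice[OF S T A])
  obtain Y where Y: "Y \<in> tensors I J" and A'YA': "A' \<star>\<^bsub>I\<^esub> (Y \<star>\<^bsub>J\<^esub> A') = A'"
    and adj_A'Y: "?adj J J T T (A' \<star>\<^bsub>I\<^esub> Y) = A' \<star>\<^bsub>I\<^esub> Y"
    using weighted_least_squares_inverse_exists[OF T S A'] by blast
  define W where "W = ?adj I J S T Y"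
  have W: "W \<in> tensors J I"
    unfolding W_def by (rule weighted_conj_transpose_in_tensors[OF S T Y])
  \<comment> \<open>Taking adjoints turns \<open>A' Y A' = A'\<close> into \<open>A W A = A\<close>,
    and \<open>A' Y\<close> into \<open>W A\<close>.\<close>
  have "?adj J I T S (A' \<star>\<^bsub>I\<^esub> (Y \<star>\<^bsub>J\<^esub> A')) = A \<star>\<^bsub>J\<^esub> (W \<star>\<^bsub>I\<^esub> A)"
    by (simp add: weighted_conj_transpose_prod[OF S A'] weighted_conj_transpose_prod[OF T Y] A''
        einstein_prod_assoc flip: W_def)
  then have AWA: "A \<star>\<^bsub>J\<^esub> (W \<star>\<^bsub>I\<^esub> A) = A" by (simp add: A'YA' A'')
  have "W \<star>\<^bsub>I\<^esub> A = ?adj J J T T (A' \<star>\<^bsub>I\<^esub> Y)"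
    by (simp add: weighted_conj_transpose_prod[OF S A'] A'' flip: W_def)
  moreover have "A' \<star>\<^bsub>I\<^esub> Y \<in> tensors J J" by (intro tensor_closed A' Y)
  ultimately have adj_WA: "?adj J J T T (W \<star>\<^bsub>I\<^esub> A) = W \<star>\<^bsub>I\<^esub> A"
    using adj_A'Y by simp
  define V where "V = W \<star>\<^bsub>I\<^esub> (A \<star>\<^bsub>J\<^esub> X)"
  have V: "V \<in> tensors J I" unfolding V_def by (intro tensor_closed W A X)
  have AV: "A \<star>\<^bsub>J\<^esub> V = A \<star>\<^bsub>J\<^esub> X" unfolding V_def using AWA by (metis einstein_prod_assoc)
  have VA: "V \<star>\<^bsub>I\<^esub> A = W \<star>\<^bsub>I\<^esub> A" unfolding V_def using AXA by (metis einstein_prod_assoc)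
  have "V \<star>\<^bsub>I\<^esub> (A \<star>\<^bsub>J\<^esub> V) = (V \<star>\<^bsub>I\<^esub> A) \<star>\<^bsub>J\<^esub> X" by (simp add: AV einstein_prod_assoc)
  also have "\<dots> = V" by (simp add: VA) (simp add: V_def einstein_prod_assoc)
  finally have "V \<star>\<^bsub>I\<^esub> (A \<star>\<^bsub>J\<^esub> V) = V" .
  then have "is_weighted_mp_inverse I J S T A V"
    unfolding is_weighted_mp_inverse_iff[OF S T A]
    using V AV VA adj_WA adj_AX AWA by simp
  then show ?thesis by blast
qed

lemma weighted_mp_inverse_eqI:
  assumes "hermitian_pos_def I S" "hermitian_pos_def J T" "A \<in> tensors I J"
    and "is_weighted_mp_inverse I J S T A X"
  shows "weighted_mp_inverse I J S T A = X"
  unfolding weighted_mp_inverse_def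
  by (rule the_equality) (use assms weighted_mp_inverse_unique in blast)+

lemma weighted_mp_inverse_props:
  assumes "hermitian_pos_def I S" "hermitian_pos_def J T" "A \<in> tensors I J"
  defines "X \<equiv> weighted_mp_inverse I J S T A"
  shows "X \<in> tensors J I"
    "A \<star>\<^bsub>J\<^esub> (X \<star>\<^bsub>I\<^esub> A) = A" "X \<star>\<^bsub>I\<^esub> (A \<star>\<^bsub>J\<^esub> X) = X"
    "weighted_conj_transpose I I S S (A \<star>\<^bsub>J\<^esub> X) = A \<star>\<^bsub>J\<^esub> X"
    "weighted_conj_transpose J J T T (X \<star>\<^bsub>I\<^esub> A) = X \<star>\<^bsub>I\<^esub> A"
proof -
  obtain Y where "is_weighted_mp_inverse I J S T A Y"
    using weighted_mp_inverse_exists[OF assms(1-3)] ..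
  with weighted_mp_inverse_eqI[OF assms(1-3)] have "is_weighted_mp_inverse I J S T A X"
    by (simp add: X_def)
  then show "X \<in> tensors J I"
    "A \<star>\<^bsub>J\<^esub> (X \<star>\<^bsub>I\<^esub> A) = A" "X \<star>\<^bsub>I\<^esub> (A \<star>\<^bsub>J\<^esub> X) = X"
    "weighted_conj_transpose I I S S (A \<star>\<^bsub>J\<^esub> X) = A \<star>\<^bsub>J\<^esub> X"
    "weighted_conj_transpose J J T T (X \<star>\<^bsub>I\<^esub> A) = X \<star>\<^bsub>I\<^esub> A"
    by (simp_all add: is_weighted_mp_inverse_iff[OF assms(1-3)])
qed

text \<open>For \<open>W = (1 - Q) P Q\<close>, the adjoint of \<open>W\<close> times
  \<open>W\<close> is \<open>Q P Q - Q P Q P Q\<close>, which vanishes because \<open>P Q\<close> is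
  idempotent. So \<open>P Q = Q P Q\<close> is self-adjoint, and its adjoint is
  \<open>Q P\<close>.\<close>

lemma weighted_projections_commute:
  assumes N: "hermitian_pos_def J N" and P: "P \<in> tensors J J" and Q: "Q \<in> tensors J J"
    and adj_P: "weighted_conj_transpose J J N N P = P"
    and adj_Q: "weighted_conj_transpose J J N N Q = Q"
    and PP: "P \<star>\<^bsub>J\<^esub> P = P" and QQ: "Q \<star>\<^bsub>J\<^esub> Q = Q"
    and PQPQ: "P \<star>\<^bsub>J\<^esub> (Q \<star>\<^bsub>J\<^esub> (P \<star>\<^bsub>J\<^esub> Q)) = P \<star>\<^bsub>J\<^esub> Q"
  shows "P \<star>\<^bsub>J\<^esub> Q = Q \<star>\<^bsub>J\<^esub> P"
proof -
  let ?adj = "weighted_conj_transpose J J N N"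
  have PP': "P \<star>\<^bsub>J\<^esub> (P \<star>\<^bsub>J\<^esub> Z) = P \<star>\<^bsub>J\<^esub> Z" and QQ': "Q \<star>\<^bsub>J\<^esub> (Q \<star>\<^bsub>J\<^esub> Z) = Q \<star>\<^bsub>J\<^esub> Z" for Z
    by (simp_all add: PP QQ flip: einstein_prod_assoc)
  note prod = weighted_conj_transpose_prod[OF N]
  define W where "W = P \<star>\<^bsub>J\<^esub> Q - Q \<star>\<^bsub>J\<^esub> (P \<star>\<^bsub>J\<^esub> Q)"
  have W: "W \<in> tensors J J" unfolding W_def by (intro tensor_closed P Q)
  have "?adj W = Q \<star>\<^bsub>J\<^esub> P - Q \<star>\<^bsub>J\<^esub> (P \<star>\<^bsub>J\<^esub> Q)"
    by (simp add: W_def weighted_conj_transpose_diff prod[OF P] prod[OF Q] adj_P adj_Q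
        einstein_prod_assoc)
  then have "?adj W \<star>\<^bsub>J\<^esub> W = 0"
    by (simp add: W_def einstein_prod_distrib einstein_prod_assoc PP' QQ' PQPQ)
  then have "W = 0" by (rule weighted_conj_transpose_self_prod_eq_0D[OF N N W])
  then have PQ: "P \<star>\<^bsub>J\<^esub> Q = Q \<star>\<^bsub>J\<^esub> (P \<star>\<^bsub>J\<^esub> Q)" by (simp add: W_def)
  have "Q \<star>\<^bsub>J\<^esub> P = ?adj (P \<star>\<^bsub>J\<^esub> Q)" by (simp add: prod[OF P] adj_P adj_Q)
  also have "\<dots> = ?adj (Q \<star>\<^bsub>J\<^esub> (P \<star>\<^bsub>J\<^esub> Q))" using PQ by simp
  also have "\<dots> = P \<star>\<^bsub>J\<^esub> Q"
    by (simp add: prod[OF P] prod[OF Q] adj_P adj_Q einstein_prod_assoc)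
      (rule PQ[symmetric])
  finally show ?thesis by simp
qed

section \<open>The reverse-order law\<close>

theorem theorem4p10:
  fixes I J K :: "nat list" and A B M N L :: tensor
  assumes "valid_dims I" and "valid_dims J" and "valid_dims K"
    and "A \<in> tensors I J" and "B \<in> tensors J K"
    and "hermitian_pos_def I M" and "hermitian_pos_def J N" and "hermitian_pos_def K L"
  shows "weighted_mp_inverse I K M L (A \<star>\<^bsub>J\<^esub> B) =
           weighted_mp_inverse J K N L B \<star>\<^bsub>J\<^esub> weighted_mp_inverse I J M N A
     \<longleftrightarrow>
       (weighted_mp_inverse I J M N A \<star>\<^bsub>I\<^esub> A \<star>\<^bsub>J\<^esub> B =
          B \<star>\<^bsub>K\<^esub> weighted_mp_inverse I K M L (A \<star>\<^bsub>J\<^esub> B) \<star>\<^bsub>I\<^esub> A \<star>\<^bsub>J\<^esub> B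
        \<and>
        B \<star>\<^bsub>K\<^esub> weighted_mp_inverse J K N L B \<star>\<^bsub>J\<^esub> weighted_conj_transpose I J M N A =
          weighted_conj_transpose I J M N A \<star>\<^bsub>I\<^esub> A \<star>\<^bsub>J\<^esub> B
            \<star>\<^bsub>K\<^esub> weighted_mp_inverse I K M L (A \<star>\<^bsub>J\<^esub> B))"
proof -
  let ?adj = "weighted_conj_transpose"
  note A = \<open>A \<in> tensors I J\<close> and B = \<open>B \<in> tensors J K\<close>
    and M = \<open>hermitian_pos_def I M\<close> and N = \<open>hermitian_pos_def J N\<close> and L = \<open>hermitian_pos_def K L\<close>
  note assoc = einstein_prod_assoc
  \<comment> \<open>In this proof \<open>A'\<close> and \<open>B'\<close> are weighted
    Moore--Penrose inverses, while \<open>As\<close> is the adjoint of \<open>A\<close>.\<close>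
  define A' where "A' = weighted_mp_inverse I J M N A"
  define B' where "B' = weighted_mp_inverse J K N L B"
  define C where "C = A \<star>\<^bsub>J\<^esub> B"
  define X where "X = weighted_mp_inverse I K M L C"
  define As where "As = ?adj I J M N A"
  have C: "C \<in> tensors I K" unfolding C_def by (intro tensor_closed A B)
  note pA = weighted_mp_inverse_props[OF M N A, folded A'_def]
    and pB = weighted_mp_inverse_props[OF N L B, folded B'_def]
    and pX = weighted_mp_inverse_props[OF M L C, folded X_def]
  have As: "As \<in> tensors J I"
    unfolding As_def by (rule weighted_conj_transpose_in_tensors[OF M N A])
  have As': "?adj J I N M As = A"
    unfolding As_def by (rule weighted_conj_transpose_twice[OF M N A])
  define P where "P = A' \<star>\<^bsub>I\<^esub> A"
  define Q where "Q = B \<star>\<^bsub>K\<^esub> B'"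
  have P: "P \<in> tensors J J" unfolding P_def by (intro tensor_closed A pA)
  have Q: "Q \<in> tensors J J" unfolding Q_def by (intro tensor_closed B pB)
  have adj_P: "?adj J J N N P = P" and adj_Q: "?adj J J N N Q = Q"
    unfolding P_def Q_def by (rule pA pB)+
  have AP: "A \<star>\<^bsub>J\<^esub> P = A" and PA': "P \<star>\<^bsub>J\<^esub> A' = A'"
    and QB: "Q \<star>\<^bsub>J\<^esub> B = B" and B'Q: "B' \<star>\<^bsub>J\<^esub> Q = B'"
    unfolding P_def Q_def by (simp_all add: assoc pA pB)
  have PP: "P \<star>\<^bsub>J\<^esub> P = P" and QQ: "Q \<star>\<^bsub>J\<^esub> Q = Q"
    using pA(2) pB(3) by (simp_all add: P_def Q_def assoc)
  \<comment> \<open>This is the adjoint of \<open>A P = A\<close>. The next three facts likewise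
    come from the adjoints of \<open>A Q A'\<close>, \<open>A' A\<close> and
    \<open>A A'\<close>.\<close>
  have PAs: "P \<star>\<^bsub>J\<^esub> As = As"
    using weighted_conj_transpose_prod[OF N A, of J M N P] by (simp add: AP adj_P As_def)
  have adj_AQA': "?adj I I M M (A \<star>\<^bsub>J\<^esub> (Q \<star>\<^bsub>J\<^esub> A')) = ?adj J I N M A' \<star>\<^bsub>J\<^esub> (Q \<star>\<^bsub>J\<^esub> As)"
    by (simp add: weighted_conj_transpose_prod[OF N A] weighted_conj_transpose_prod[OF N Q]
        adj_Q assoc flip: As_def)
  have AsA's: "As \<star>\<^bsub>I\<^esub> ?adj J I N M A' = P"
    using weighted_conj_transpose_prod[OF M pA(1), of J N N A] adj_P by (simp add: As_def P_def)
  have A'sAs: "?adj J I N M A' \<star>\<^bsub>J\<^esub> As = A \<star>\<^bsub>J\<^esub> A'"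
    using weighted_conj_transpose_prod[OF N A, of I M M A'] pA(4) by (simp add: As_def)
  have "X = B' \<star>\<^bsub>J\<^esub> A' \<longleftrightarrow>
    P \<star>\<^bsub>J\<^esub> B = B \<star>\<^bsub>K\<^esub> (X \<star>\<^bsub>I\<^esub> C) \<and> Q \<star>\<^bsub>J\<^esub> As = As \<star>\<^bsub>I\<^esub> (C \<star>\<^bsub>K\<^esub> X)"
  proof (intro iffI conjI; (elim conjE)?)
    assume X_eq: "X = B' \<star>\<^bsub>J\<^esub> A'"
    \<comment> \<open>Placing \<open>C X C = C\<close> between \<open>A'\<close> and
      \<open>B'\<close> and inserting \<open>X = B' A'\<close> shows that \<open>P Q\<close> is
      idempotent.\<close>
    have "A' \<star>\<^bsub>I\<^esub> ((C \<star>\<^bsub>K\<^esub> (X \<star>\<^bsub>I\<^esub> C)) \<star>\<^bsub>K\<^esub> B') = A' \<star>\<^bsub>I\<^esub> (C \<star>\<^bsub>K\<^esub> B')"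
      by (simp add: pX)
    then have "P \<star>\<^bsub>J\<^esub> (Q \<star>\<^bsub>J\<^esub> (P \<star>\<^bsub>J\<^esub> Q)) = P \<star>\<^bsub>J\<^esub> Q"
      by (simp add: X_eq C_def P_def Q_def assoc)
    from weighted_projections_commute[OF N P Q adj_P adj_Q PP QQ this]
    have PQ: "P \<star>\<^bsub>J\<^esub> Q = Q \<star>\<^bsub>J\<^esub> P" .
    have "P \<star>\<^bsub>J\<^esub> B = (P \<star>\<^bsub>J\<^esub> Q) \<star>\<^bsub>J\<^esub> B" by (simp add: assoc QB)
    also have "\<dots> = B \<star>\<^bsub>K\<^esub> (X \<star>\<^bsub>I\<^esub> C)"
      by (simp add: PQ X_eq C_def) (simp add: P_def Q_def assoc)
    finally show "P \<star>\<^bsub>J\<^esub> B = B \<star>\<^bsub>K\<^esub> (X \<star>\<^bsub>I\<^esub> C)" .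
    have CX: "C \<star>\<^bsub>K\<^esub> X = A \<star>\<^bsub>J\<^esub> (Q \<star>\<^bsub>J\<^esub> A')" by (simp add: X_eq C_def Q_def assoc)
    \<comment> \<open>Replacing the self-adjoint \<open>C X = A Q A'\<close> by its adjoint moves
      the adjoint of \<open>A'\<close> next to \<open>As\<close>, where the two multiply to
      \<open>P\<close>.\<close>
    have "As \<star>\<^bsub>I\<^esub> (C \<star>\<^bsub>K\<^esub> X) = As \<star>\<^bsub>I\<^esub> ?adj I I M M (C \<star>\<^bsub>K\<^esub> X)" by (simp add: pX)
    also have "\<dots> = As \<star>\<^bsub>I\<^esub> (?adj J I N M A' \<star>\<^bsub>J\<^esub> (Q \<star>\<^bsub>J\<^esub> As))"
      by (simp only: CX adj_AQA')
    also have "\<dots> = (P \<star>\<^bsub>J\<^esub> Q) \<star>\<^bsub>J\<^esub> As" by (simp add: assoc flip: AsA's)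
    also have "\<dots> = Q \<star>\<^bsub>J\<^esub> As" unfolding PQ by (simp add: assoc PAs)
    finally show "Q \<star>\<^bsub>J\<^esub> As = As \<star>\<^bsub>I\<^esub> (C \<star>\<^bsub>K\<^esub> X)" by simp
  next
    assume 1: "P \<star>\<^bsub>J\<^esub> B = B \<star>\<^bsub>K\<^esub> (X \<star>\<^bsub>I\<^esub> C)" and 2: "Q \<star>\<^bsub>J\<^esub> As = As \<star>\<^bsub>I\<^esub> (C \<star>\<^bsub>K\<^esub> X)"
    define Y where "Y = B' \<star>\<^bsub>J\<^esub> A'"
    have Y: "Y \<in> tensors K I" unfolding Y_def by (intro tensor_closed pA pB)
    \<comment> \<open>By the first equation \<open>P B\<close> has \<open>B\<close> as its left
      factor, so \<open>Q\<close> fixes it. Multiplying by \<open>B'\<close> on the right gives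
      \<open>Q P Q = P Q\<close>.\<close>
    have "Q \<star>\<^bsub>J\<^esub> (P \<star>\<^bsub>J\<^esub> B) = P \<star>\<^bsub>J\<^esub> B" unfolding 1 by (simp add: QB flip: assoc)
    then have QPQ: "Q \<star>\<^bsub>J\<^esub> (P \<star>\<^bsub>J\<^esub> Q) = P \<star>\<^bsub>J\<^esub> Q"
      unfolding Q_def by (metis assoc)
    have PQ: "P \<star>\<^bsub>J\<^esub> Q = Q \<star>\<^bsub>J\<^esub> P"
    proof (rule weighted_projections_commute[OF N P Q adj_P adj_Q PP QQ])
      show "P \<star>\<^bsub>J\<^esub> (Q \<star>\<^bsub>J\<^esub> (P \<star>\<^bsub>J\<^esub> Q)) = P \<star>\<^bsub>J\<^esub> Q"
        unfolding QPQ by (simp add: PP flip: assoc)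
    qed
    have BB: "B' \<star>\<^bsub>J\<^esub> B \<in> tensors K K" and XC: "X \<star>\<^bsub>I\<^esub> C \<in> tensors K K"
      by (intro tensor_closed pB B pX C)+
    \<comment> \<open>Both \<open>X C\<close> and \<open>B' B\<close> are self-adjoint, so the
      adjoint of this equation lets \<open>B' B\<close> absorb into \<open>X C\<close> from the
      left. With the first equation, \<open>Y C = B' P B = B' B X C = X C\<close>.\<close>
    have "(X \<star>\<^bsub>I\<^esub> C) \<star>\<^bsub>K\<^esub> (B' \<star>\<^bsub>J\<^esub> B) = X \<star>\<^bsub>I\<^esub> C"
      by (simp add: C_def assoc pB)
    with weighted_conj_transpose_prod[OF L XC, of K L L "B' \<star>\<^bsub>J\<^esub> B"]
    have "(B' \<star>\<^bsub>J\<^esub> B) \<star>\<^bsub>K\<^esub> (X \<star>\<^bsub>I\<^esub> C) = X \<star>\<^bsub>I\<^esub> C" by (simp add: pX pB)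
    moreover have "Y \<star>\<^bsub>I\<^esub> C = B' \<star>\<^bsub>J\<^esub> (P \<star>\<^bsub>J\<^esub> B)" by (simp add: Y_def C_def P_def assoc)
    ultimately have YC: "Y \<star>\<^bsub>I\<^esub> C = X \<star>\<^bsub>I\<^esub> C" by (simp add: 1 assoc)
    have AQA': "A \<star>\<^bsub>J\<^esub> (Q \<star>\<^bsub>J\<^esub> A') \<in> tensors I I" by (intro tensor_closed A Q pA)
    \<comment> \<open>The second equation turns the adjoint of \<open>C Y = A Q A'\<close> into
      \<open>A A' C X = C X\<close>. Since \<open>C X\<close> is self-adjoint,
      \<open>C Y = C X\<close>.\<close>
    have "?adj I I M M (A \<star>\<^bsub>J\<^esub> (Q \<star>\<^bsub>J\<^esub> A')) = (?adj J I N M A' \<star>\<^bsub>J\<^esub> As) \<star>\<^bsub>I\<^esub> (C \<star>\<^bsub>K\<^esub> X)"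
      unfolding adj_AQA' 2 by (simp add: assoc)
    also have "\<dots> = (A \<star>\<^bsub>J\<^esub> P) \<star>\<^bsub>J\<^esub> (B \<star>\<^bsub>K\<^esub> X)"
      unfolding A'sAs by (simp add: C_def P_def assoc)
    also have "\<dots> = C \<star>\<^bsub>K\<^esub> X" by (simp add: AP C_def assoc)
    finally have "A \<star>\<^bsub>J\<^esub> (Q \<star>\<^bsub>J\<^esub> A') = ?adj I I M M (C \<star>\<^bsub>K\<^esub> X)"
      using weighted_conj_transpose_twice[OF M M AQA'] by simp
    then have CY: "C \<star>\<^bsub>K\<^esub> Y = C \<star>\<^bsub>K\<^esub> X"
      by (simp add: pX) (simp add: C_def Y_def Q_def assoc)
    \<comment> \<open>Commutation moves \<open>Q\<close> next to \<open>B'\<close> and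
      \<open>P\<close> next to \<open>A'\<close>, where each is absorbed. The other Penrose
      conditions pass from \<open>X\<close> to \<open>Y\<close> through \<open>C Y = C X\<close> and
      \<open>Y C = X C\<close>.\<close>
    have "Y \<star>\<^bsub>I\<^esub> (C \<star>\<^bsub>K\<^esub> Y) = B' \<star>\<^bsub>J\<^esub> ((P \<star>\<^bsub>J\<^esub> Q) \<star>\<^bsub>J\<^esub> A')"
      by (simp add: Y_def C_def P_def Q_def assoc)
    also have "\<dots> = (B' \<star>\<^bsub>J\<^esub> Q) \<star>\<^bsub>J\<^esub> (P \<star>\<^bsub>J\<^esub> A')" unfolding PQ by (simp add: assoc)
    also have "\<dots> = Y" by (simp add: B'Q PA' Y_def)
    finally have "is_weighted_mp_inverse I K M L C Y"
      using Y pX by (simp add: is_weighted_mp_inverse_iff[OF M L C] YC CY)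
    from weighted_mp_inverse_eqI[OF M L C this] show "X = B' \<star>\<^bsub>J\<^esub> A'"
      by (simp add: X_def Y_def)
  qed
  then show ?thesis
    by (simp only: A'_def B'_def X_def As_def C_def P_def Q_def assoc)
qed

end
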